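(* Let $(\mathfrak{g},[\,,\,])$ be a Leibniz algebra and let $N:\mathfrak{g}\to\mathfrak{g}$ be a linear operator. Then: (a) If $N^2=0$, then $N$ is a Nijenhuis operator if and only if $N$ is a Rota-Baxter operator. (b) If $N^2=N$, then $N$ is a Nijenhuis operator if and only if $N$ is a Rota-Baxter operator of weight $-1$. (c) If $N^2=\pm\mathrm{Id}$, then $N$ is a Nijenhuis operator if and only if $N$ is a modified Rota-Baxter operator of weight $\mp 1$ (that is, weight $-1$ if $N^2=\mathrm{Id}$ and weight $+1$ if $N^2=-\mathrm{Id}$).
   Context: All vector spaces are over a field $\mathbb{K}$ of characteristic $0$. A (left) Leibniz algebra is a vector space $\mathfrak{g}$ with a bilinear bracket satisfying $[x,[y,z]]=[[x,y],z]+[y,[x,z]]$ for all $x,y,z\in\mathfrak{g}$. For a linear operator $N:\mathfrak{g}\to\mathfrak{g}$ and $\lambda\in\mathbb{K}$ (each identity required for all $x,y\in\mathfrak{g}$): - $N$ is a Nijenhuis operator if $[Nx,Ny]=N\big([Nx,y]+[x,Ny]-N[x,y]\big)$; - $N$ is a Rota-Baxter operator if $[Nx,Ny]=N\big([x,Ny]+[Nx,y]\big)$; - $N$ is a Rota-Baxter operator of weight $\lambda$ if $[Nx,Ny]=N\big([x,Ny]+[Nx,y]+\lambda[x,y]\big)$; - $N$ is a modified Rota-Baxter operator of weight $\lambda$ if $[Nx,Ny]=N\big([x,Ny]+[Nx,y]\big)+\lambda[x,y]$. *)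

theory Defs
  imports Complex_Main
begin

text \<open>The vector space is the whole type \<open>'a\<close>, with scalar multiplication \<open>scale\<close> by a field of
  characteristic 0; no finiteness of dimension is assumed.\<close>

locale leibniz_algebra = vector_space scale
  for scale :: "'k::field_char_0 \<Rightarrow> 'a::ab_group_add \<Rightarrow> 'a" +
  fixes bracket :: "'a \<Rightarrow> 'a \<Rightarrow> 'a"
  assumes bracket_linear_right: "Vector_Spaces.linear scale scale (\<lambda>y. bracket x y)"
    and bracket_linear_left: "Vector_Spaces.linear scale scale (\<lambda>x. bracket x y)"
    and leibniz: "bracket x (bracket y z) = bracket (bracket x y) z + bracket y (bracket x z)"
begin

definition nijenhuis_operator :: "('a \<Rightarrow> 'a) \<Rightarrow> bool" where
  "nijenhuis_operator N \<longleftrightarrow> Vector_Spaces.linear scale scale N \<and>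
    (\<forall>x y. bracket (N x) (N y) = N (bracket (N x) y + bracket x (N y) - N (bracket x y)))"

definition rota_baxter_operator :: "('a \<Rightarrow> 'a) \<Rightarrow> bool" where
  "rota_baxter_operator N \<longleftrightarrow> Vector_Spaces.linear scale scale N \<and>
    (\<forall>x y. bracket (N x) (N y) = N (bracket x (N y) + bracket (N x) y))"

definition weighted_rota_baxter_operator :: "'k \<Rightarrow> ('a \<Rightarrow> 'a) \<Rightarrow> bool" where
  "weighted_rota_baxter_operator w N \<longleftrightarrow> Vector_Spaces.linear scale scale N \<and>
    (\<forall>x y. bracket (N x) (N y) =
      N (bracket x (N y) + bracket (N x) y + scale w (bracket x y)))"

text \<open>Here the weight term stands outside \<open>N\<close>.\<close>

definition modified_rota_baxter_operator :: "'k \<Rightarrow> ('a \<Rightarrow> 'a) \<Rightarrow> bool" where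
  "modified_rota_baxter_operator w N \<longleftrightarrow> Vector_Spaces.linear scale scale N \<and>
    (\<forall>x y. bracket (N x) (N y) =
      N (bracket x (N y) + bracket (N x) y) + scale w (bracket x y))"

end

end

theory Submission
  imports Defs
begin

text \<open>By linearity the right-hand side of the Nijenhuis identity is
  \<open>N ([x, N y] + [N x, y]) - N (N [x, y])\<close>. Each notion of Rota-Baxter operator has the same
  first summand, followed by a correction term: \<open>0\<close>, \<open>- N [x, y]\<close>, or \<open>[x, y]\<close> up to sign.
  The respective hypothesis on \<open>N \<circ> N\<close> turns \<open>- N (N [x, y])\<close> into that term, so the two
  identities coincide for each pair \<open>x, y\<close>.\<close>

context leibniz_algebra
begin

lemma nijenhuis_operator_iff_square:
  assumes "Vector_Spaces.linear scale scale N"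
  shows "nijenhuis_operator N \<longleftrightarrow>
    (\<forall>x y. bracket (N x) (N y) =
      N (bracket x (N y) + bracket (N x) y) - (N \<circ> N) (bracket x y))"
proof -
  interpret N: Vector_Spaces.linear scale scale N by (fact assms)
  show ?thesis
    using assms by (simp add: nijenhuis_operator_def N.add N.diff add.commute)
qed

lemma weighted_rota_baxter_operator_minus_one_iff:
  assumes "Vector_Spaces.linear scale scale N"
  shows "weighted_rota_baxter_operator (-1) N \<longleftrightarrow>
    (\<forall>x y. bracket (N x) (N y) =
      N (bracket x (N y) + bracket (N x) y) - N (bracket x y))"
proof -
  interpret N: Vector_Spaces.linear scale scale N by (fact assms)
  show ?thesis
    using assms by (simp add: weighted_rota_baxter_operator_def N.add N.diff)
qed

end

theorem proposition2p11:
  fixes scale :: "'k::field_char_0 \<Rightarrow> 'a::ab_group_add \<Rightarrow> 'a"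
    and bracket :: "'a \<Rightarrow> 'a \<Rightarrow> 'a"
    and N :: "'a \<Rightarrow> 'a"
  assumes "leibniz_algebra scale bracket"
    and "Vector_Spaces.linear scale scale N"
  shows "(N \<circ> N = (\<lambda>x. 0) \<longrightarrow>
        (leibniz_algebra.nijenhuis_operator scale bracket N \<longleftrightarrow>
         leibniz_algebra.rota_baxter_operator scale bracket N)) \<and>
      (N \<circ> N = N \<longrightarrow>
        (leibniz_algebra.nijenhuis_operator scale bracket N \<longleftrightarrow>
         leibniz_algebra.weighted_rota_baxter_operator scale bracket (-1) N)) \<and>
      (N \<circ> N = id \<longrightarrow>
        (leibniz_algebra.nijenhuis_operator scale bracket N \<longleftrightarrow>
         leibniz_algebra.modified_rota_baxter_operator scale bracket (-1) N)) \<and>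
      (N \<circ> N = (\<lambda>x. - x) \<longrightarrow>
        (leibniz_algebra.nijenhuis_operator scale bracket N \<longleftrightarrow>
         leibniz_algebra.modified_rota_baxter_operator scale bracket 1 N))"
proof -
  interpret leibniz_algebra scale bracket by (fact assms(1))
  note square = nijenhuis_operator_iff_square[OF assms(2)]
  have "nijenhuis_operator N \<longleftrightarrow> rota_baxter_operator N" if "N \<circ> N = (\<lambda>x. 0)"
    unfolding square that rota_baxter_operator_def using assms(2) by simp
  moreover have "nijenhuis_operator N \<longleftrightarrow> weighted_rota_baxter_operator (-1) N" if "N \<circ> N = N"
    unfolding square that weighted_rota_baxter_operator_minus_one_iff[OF assms(2)] by (rule refl)
  moreover have "nijenhuis_operator N \<longleftrightarrow> modified_rota_baxter_operator (-1) N" if "N \<circ> N = id"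
    unfolding square that modified_rota_baxter_operator_def using assms(2) by simp
  moreover have "nijenhuis_operator N \<longleftrightarrow> modified_rota_baxter_operator 1 N"
    if "N \<circ> N = (\<lambda>x. - x)"
    unfolding square that modified_rota_baxter_operator_def using assms(2) by simp
  ultimately show ?thesis by blast
qed

end
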